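(* Let $G^{\mathrm{full}}=(L,E^{\mathrm{full}})$ be the full single-reference excitation graph with $K$ orbitals and $N$ particles, where $2N\le K<\infty$. Then the following properties hold true. (i) The number of vertices is $|L|=\binom{K}{N}$. (ii) The number of vertices of rank $r$ is $|L(r)|=\binom{N}{r}\binom{K-N}{r}$. (iii) There are no edges in $E^{\mathrm{full}}$ entirely inside $L(r)$, and the number of edges from $L(r)$ to $L(r+s)$ is given by $$|E(r,r+s)|=\binom{K-N}{r}\binom{K-N-r}{s}\binom{N}{s+r}\binom{s+r}{r}$$ for all $r=0,1,\dots,N$ and $s=1,\dots,N-r$, and $|E(r,r+s)|=0$ if $s=N-r+1,\dots,N$. Furthermore, the symmetry property $|E(r,r+s)|=|E(s,r+s)|$ holds true for $r,s\ge1$. (iv) The total number of edges is $$|E^{\mathrm{full}}|=\sum_{r=1}^N\binom{N}{r}\binom{K-N}{r}\binom{K-2r}{N-r}.$$ (v) For $\gamma\in L$ with $r=\mathrm{rk}(\gamma)$ and $1\le n\le r$, the number of directed paths of length $n$ from $0$ to $\gamma$ in $G^{\mathrm{full}}$ equals $$p(r,n)=\sum_{\substack{r_1+\dots+r_n=r\\ r_1,\dots,r_n\ge1}}\left(\frac{r!}{r_1!\cdots r_n!}\right)^2.$$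
   Context: Let $\Lambda$ be a set of $K$ elements (orbitals), let $N\ge1$, and let $L=\{\alpha\subset\Lambda:|\alpha|=N\}$. Fix a reference state $0\in L$. For $\alpha\in L$ put $\underline{\alpha}=\alpha\cap0$, $\overline{\alpha}=\alpha\setminus0$ and define the rank $\mathrm{rk}(\alpha)=|\overline{\alpha}|$; let $L(r)=\{\alpha\in L:\mathrm{rk}(\alpha)=r\}$. For $\alpha,\beta\in L$ put $\alpha\vee\beta=(\underline{\alpha}\cap\underline{\beta})\cup(\overline{\alpha}\cup\overline{\beta})$. Let $$\mathcal{L}=\{(\alpha,\beta)\in L\times L:\ |\underline{\alpha}\cup\underline{\beta}|=N,\ |\overline{\alpha}\cap\overline{\beta}|=0\};$$ for $(\alpha,\beta)\in\mathcal{L}$ one has $\alpha\vee\beta\in L$. The full (single-reference) excitation graph is the digraph $G^{\mathrm{full}}=(L,E^{\mathrm{full}})$ with $$E^{\mathrm{full}}=\{(\beta,\alpha\vee\beta):(\alpha,\beta)\in\mathcal{L},\ \alpha\ne0\}.$$ $E(r,r+s)$ denotes the set of edges in $E^{\mathrm{full}}$ from a vertex in $L(r)$ to a vertex in $L(r+s)$. A directed path of length $n$ is a sequence of $n$ consecutive directed edges. *)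

theory Defs
  imports Complex_Main "Graph_Theory.Pair_Digraph"
begin

text \<open>
  \<open>\<Lambda>\<close> is the set of orbitals, \<open>N\<close> the number of particles and \<open>\<phi>\<close> the reference state
  (the state usually written \<open>0\<close>).
\<close>

definition states :: "'a set \<Rightarrow> nat \<Rightarrow> 'a set set" where
  "states \<Lambda> N = {\<alpha>. \<alpha> \<subseteq> \<Lambda> \<and> card \<alpha> = N}"

definition occ :: "'a set \<Rightarrow> 'a set \<Rightarrow> 'a set" where
  "occ \<phi> \<alpha> = \<alpha> \<inter> \<phi>"

definition virt :: "'a set \<Rightarrow> 'a set \<Rightarrow> 'a set" where
  "virt \<phi> \<alpha> = \<alpha> - \<phi>"

definition rk :: "'a set \<Rightarrow> 'a set \<Rightarrow> nat" where
  "rk \<phi> \<alpha> = card (virt \<phi> \<alpha>)"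

definition states_of_rank :: "'a set \<Rightarrow> nat \<Rightarrow> 'a set \<Rightarrow> nat \<Rightarrow> 'a set set" where
  "states_of_rank \<Lambda> N \<phi> r = {\<alpha> \<in> states \<Lambda> N. rk \<phi> \<alpha> = r}"

definition join :: "'a set \<Rightarrow> 'a set \<Rightarrow> 'a set \<Rightarrow> 'a set" where
  "join \<phi> \<alpha> \<beta> = (occ \<phi> \<alpha> \<inter> occ \<phi> \<beta>) \<union> (virt \<phi> \<alpha> \<union> virt \<phi> \<beta>)"

definition compatible :: "'a set \<Rightarrow> nat \<Rightarrow> 'a set \<Rightarrow> ('a set \<times> 'a set) set" where
  "compatible \<Lambda> N \<phi> = {(\<alpha>, \<beta>). \<alpha> \<in> states \<Lambda> N \<and> \<beta> \<in> states \<Lambda> N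
     \<and> card (occ \<phi> \<alpha> \<union> occ \<phi> \<beta>) = N \<and> card (virt \<phi> \<alpha> \<inter> virt \<phi> \<beta>) = 0}"

definition full_edges :: "'a set \<Rightarrow> nat \<Rightarrow> 'a set \<Rightarrow> ('a set \<times> 'a set) set" where
  "full_edges \<Lambda> N \<phi> =
     {(\<beta>, join \<phi> \<alpha> \<beta>) | \<alpha> \<beta>. (\<alpha>, \<beta>) \<in> compatible \<Lambda> N \<phi> \<and> \<alpha> \<noteq> \<phi>}"

definition full_graph :: "'a set \<Rightarrow> nat \<Rightarrow> 'a set \<Rightarrow> 'a set pair_pre_digraph" where
  "full_graph \<Lambda> N \<phi> = \<lparr> pverts = states \<Lambda> N, parcs = full_edges \<Lambda> N \<phi> \<rparr>"

definition edges_between ::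
    "'a set \<Rightarrow> nat \<Rightarrow> 'a set \<Rightarrow> nat \<Rightarrow> nat \<Rightarrow> ('a set \<times> 'a set) set" where
  "edges_between \<Lambda> N \<phi> r t = {e \<in> parcs (full_graph \<Lambda> N \<phi>).
     fst e \<in> states_of_rank \<Lambda> N \<phi> r \<and> snd e \<in> states_of_rank \<Lambda> N \<phi> t}"

text \<open>
  A directed path is a list of consecutive arcs; its length is the number of arcs.
  No distinctness of vertices is imposed, so this is \<open>awalk\<close> rather than \<open>apath\<close>.
\<close>
definition directed_paths ::
    "'v pair_pre_digraph \<Rightarrow> nat \<Rightarrow> 'v \<Rightarrow> 'v \<Rightarrow> ('v \<times> 'v) list set" where
  "directed_paths G n u v = {p. pre_digraph.awalk (with_proj G) u p v \<and> length p = n}"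

definition positive_compositions :: "nat \<Rightarrow> nat \<Rightarrow> nat list set" where
  "positive_compositions r n =
     {rs. length rs = n \<and> sum_list rs = r \<and> (\<forall>k \<in> set rs. 1 \<le> k)}"

definition path_number :: "nat \<Rightarrow> nat \<Rightarrow> real" where
  "path_number r n =
     (\<Sum>rs \<in> positive_compositions r n. (fact r / (\<Prod>i<n. fact (rs ! i)))\<^sup>2)"

end

theory Submission
  imports Defs
begin

text \<open>
  A state \<open>\<alpha>\<close> is the same thing as a pair consisting of its holes \<open>\<phi> - \<alpha>\<close> and its particles
  \<open>\<alpha> - \<phi>\<close>, two sets of equal size, namely the rank, with the holes inside \<open>\<phi>\<close> and the particles
  inside \<open>\<Lambda> - \<phi>\<close>. In this picture \<open>\<alpha>\<close> and \<open>\<beta>\<close> are compatible iff their holes are disjoint and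
  their particles are disjoint, and \<open>join\<close> unites holes with holes and particles with particles.
  Ranks therefore add under the join, \<open>\<alpha>\<close> can be recovered from \<open>\<beta>\<close> and \<open>join \<phi> \<alpha> \<beta>\<close>, and an
  arc leads from \<open>\<beta>\<close> to \<open>\<gamma>\<close> exactly when the holes and particles of \<open>\<beta>\<close> lie among those of
  \<open>\<gamma>\<close> and its rank is smaller.

  All cardinalities reduce to one count (\<open>card_window_rank\<close>): there are
  \<open>(card A choose k) * (card B choose k)\<close> states of rank \<open>k\<close> with holes in \<open>A\<close> and particles
  in \<open>B\<close>. With \<open>A = \<phi>\<close> and \<open>B = \<Lambda> - \<phi>\<close> it counts the states of a given rank. With what a state
  \<open>\<alpha>\<close> leaves free, it counts the partners of \<open>\<alpha>\<close> in the join; as arcs correspond to compatible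
  pairs, this gives the arcs between two ranks, and, after summation over the rank of the partner
  by Vandermonde's identity, all arcs. With the holes and particles of \<open>\<gamma>\<close>, it counts the
  predecessors of \<open>\<gamma>\<close>: there are \<open>(r choose k)\<^sup>2\<close> of rank \<open>k < r = rk \<phi> \<gamma>\<close>. Splitting off the
  last arc, the number of walks from \<open>\<phi>\<close> satisfies the recursion with these weights, and so does
  the sum of squared multinomial coefficients when the first part \<open>r - k\<close> of each composition is
  split off (\<open>path_number_Suc\<close>).
\<close>

section \<open>States as pairs of holes and particles\<close>

locale reference_state =
  fixes \<Lambda> :: "'a set" and \<phi> :: "'a set" and N :: nat
  assumes finite_orbitals: "finite \<Lambda>" and reference: "\<phi> \<in> states \<Lambda> N"
begin

lemma reference_subset: "\<phi> \<subseteq> \<Lambda>" and card_reference: "card \<phi> = N"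
  using reference by (auto simp: states_def)

lemma finite_reference: "finite \<phi>"
  using reference_subset finite_orbitals finite_subset by blast

lemma finite_states: "finite (states \<Lambda> N)"
  using finite_orbitals by (auto simp: states_def)

text \<open>
  Exchanging orbitals of \<open>\<phi>\<close> for others keeps the number of particles iff as many are removed
  as are added. Membership in \<open>states\<close> becomes a condition on holes and particles alone.
\<close>
lemma states_iff_card_holes_eq_card_particles:
  "\<alpha> \<in> states \<Lambda> N \<longleftrightarrow> \<alpha> \<subseteq> \<Lambda> \<and> card (\<phi> - \<alpha>) = card (\<alpha> - \<phi>)"
proof (cases "\<alpha> \<subseteq> \<Lambda>")
  case True
  then have fin: "finite \<alpha>"
    using finite_orbitals finite_subset by blast
  have "card \<phi> = card (\<phi> \<inter> \<alpha>) + card (\<phi> - \<alpha>)"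
    using finite_reference by (simp add: card_Int_Diff)
  moreover have "card \<alpha> = card (\<phi> \<inter> \<alpha>) + card (\<alpha> - \<phi>)"
    using fin by (metis Int_commute card_Int_Diff)
  ultimately show ?thesis
    using True card_reference by (auto simp: states_def)
qed (auto simp: states_def)

lemma card_holes: "\<alpha> \<in> states \<Lambda> N \<Longrightarrow> card (\<phi> - \<alpha>) = rk \<phi> \<alpha>"
  by (simp add: states_iff_card_holes_eq_card_particles rk_def virt_def)

lemma card_particles: "card (\<alpha> - \<phi>) = rk \<phi> \<alpha>"
  by (simp add: rk_def virt_def)

lemma finite_particles: "\<alpha> \<in> states \<Lambda> N \<Longrightarrow> finite (\<alpha> - \<phi>)"
  using finite_orbitals finite_subset by (auto simp: states_def)

lemma rk_le: "\<alpha> \<in> states \<Lambda> N \<Longrightarrow> rk \<phi> \<alpha> \<le> N"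
  using card_holes card_mono[of \<phi> "\<phi> - \<alpha>"] finite_reference card_reference by auto

lemma state_eqI: "\<phi> - \<alpha> = \<phi> - \<beta> \<Longrightarrow> \<alpha> - \<phi> = \<beta> - \<phi> \<Longrightarrow> \<alpha> = \<beta>"
  by blast

lemma rk_eq_0_iff: "\<alpha> \<in> states \<Lambda> N \<Longrightarrow> rk \<phi> \<alpha> = 0 \<longleftrightarrow> \<alpha> = \<phi>"
  using card_holes[of \<alpha>] card_particles[of \<alpha>] finite_reference finite_particles[of \<alpha>]
  by (auto)

section \<open>Counting states inside a window\<close>

definition window :: "'a set \<Rightarrow> 'a set \<Rightarrow> 'a set set" where
  "window A B = {\<beta> \<in> states \<Lambda> N. \<phi> - \<beta> \<subseteq> A \<and> \<beta> - \<phi> \<subseteq> B}"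

lemma finite_window: "finite (window A B)"
  using finite_states by (simp add: window_def)

text \<open>
  Holes and particles can be chosen independently, as \<open>k\<close>-subsets of \<open>A\<close> and of \<open>B\<close>; the
  state with holes \<open>H\<close> and particles \<open>P\<close> is \<open>(\<phi> - H) \<union> P\<close>.
\<close>
lemma card_window_rank:
  assumes A: "A \<subseteq> \<phi>" and B: "B \<subseteq> \<Lambda> - \<phi>"
  shows "card {\<beta> \<in> window A B. rk \<phi> \<beta> = k} = (card A choose k) * (card B choose k)"
proof -
  let ?S = "{H. H \<subseteq> A \<and> card H = k} \<times> {P. P \<subseteq> B \<and> card P = k}"
  have "bij_betw (\<lambda>\<beta>. (\<phi> - \<beta>, \<beta> - \<phi>)) {\<beta> \<in> window A B. rk \<phi> \<beta> = k} ?S"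
  proof (rule bij_betw_byWitness[where f' = "\<lambda>(H, P). (\<phi> - H) \<union> P"])
    show "(\<lambda>\<beta>. (\<phi> - \<beta>, \<beta> - \<phi>)) ` {\<beta> \<in> window A B. rk \<phi> \<beta> = k} \<subseteq> ?S"
      by (auto simp: window_def card_holes card_particles)
    have "(\<phi> - H) \<union> P \<in> {\<beta> \<in> window A B. rk \<phi> \<beta> = k}" if "(H, P) \<in> ?S" for H P
    proof -
      have "\<phi> - ((\<phi> - H) \<union> P) = H" "((\<phi> - H) \<union> P) - \<phi> = P" "(\<phi> - H) \<union> P \<subseteq> \<Lambda>"
        using that A B reference_subset by blast+
      then show ?thesis
        using that by (simp add: window_def states_iff_card_holes_eq_card_particles rk_def virt_def)
    qed
    then show "(\<lambda>(H, P). (\<phi> - H) \<union> P) ` ?S \<subseteq> {\<beta> \<in> window A B. rk \<phi> \<beta> = k}"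
      by auto
  qed (use A B in auto)
  then have "card {\<beta> \<in> window A B. rk \<phi> \<beta> = k} = card ?S"
    by (rule bij_betw_same_card)
  moreover have "finite A" "finite B"
    using A B finite_reference finite_orbitals by (auto dest: finite_subset)
  ultimately show ?thesis
    by (simp add: card_cartesian_product n_subsets)
qed

lemma sum_window_by_rank:
  fixes f :: "nat \<Rightarrow> 'b :: comm_semiring_1"
  assumes A: "A \<subseteq> \<phi>" and B: "B \<subseteq> \<Lambda> - \<phi>" and R: "finite R"
  shows "(\<Sum>\<beta> | \<beta> \<in> window A B \<and> rk \<phi> \<beta> \<in> R. f (rk \<phi> \<beta>))
    = (\<Sum>k\<in>R. of_nat ((card A choose k) * (card B choose k)) * f k)"
proof -
  let ?W = "{\<beta> \<in> window A B. rk \<phi> \<beta> \<in> R}"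
  have "(\<Sum>k\<in>R. \<Sum>\<beta> | \<beta> \<in> ?W \<and> rk \<phi> \<beta> = k. f (rk \<phi> \<beta>)) = (\<Sum>\<beta>\<in>?W. f (rk \<phi> \<beta>))"
    by (rule sum.group) (use finite_window R in auto)
  moreover have "(\<Sum>\<beta> | \<beta> \<in> ?W \<and> rk \<phi> \<beta> = k. f (rk \<phi> \<beta>))
      = of_nat ((card A choose k) * (card B choose k)) * f k" if "k \<in> R" for k
  proof -
    have "{\<beta>. \<beta> \<in> ?W \<and> rk \<phi> \<beta> = k} = {\<beta> \<in> window A B. rk \<phi> \<beta> = k}"
      using that by auto
    then show ?thesis
      using card_window_rank[OF A B, of k] by simp
  qed
  ultimately show ?thesis
    by simp
qed

text \<open>
  What Vandermonde's identity gives here can also be seen directly: the complement in \<open>A\<close> of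
  the holes together with the particles is an arbitrary subset of \<open>A \<union> B\<close> of size \<open>card A\<close>.
\<close>
lemma card_window:
  assumes A: "A \<subseteq> \<phi>" and B: "B \<subseteq> \<Lambda> - \<phi>"
  shows "card (window A B) = (card A + card B) choose card A"
proof -
  have fin: "finite A"
    using A finite_reference finite_subset by blast
  have "rk \<phi> \<beta> \<le> card A" if "\<beta> \<in> window A B" for \<beta>
    using that card_mono[OF fin, of "\<phi> - \<beta>"] card_holes[of \<beta>] by (simp add: window_def)
  then have "{\<beta>. \<beta> \<in> window A B \<and> rk \<phi> \<beta> \<in> {..card A}} = window A B"
    by auto
  then have "card (window A B) = (\<Sum>k\<le>card A. (card A choose k) * (card B choose k))"
    using sum_window_by_rank[OF A B, of "{..card A}" "\<lambda>_. 1 :: nat"] by simp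
  also have "\<dots> = (\<Sum>k\<le>card A. (card B choose k) * (card A choose (card A - k)))"
    by (intro sum.cong refl) (metis atMost_iff binomial_symmetric mult.commute)
  also have "\<dots> = (card B + card A) choose card A"
    by (rule vandermonde)
  finally show ?thesis
    by (simp add: add.commute)
qed

lemma window_full: "window \<phi> (\<Lambda> - \<phi>) = states \<Lambda> N"
  by (auto simp: window_def states_def)

lemma card_virtuals: "card (\<Lambda> - \<phi>) = card \<Lambda> - N"
  using card_Diff_subset[OF finite_reference reference_subset] card_reference by simp

lemma card_states_of_rank:
  "card (states_of_rank \<Lambda> N \<phi> r) = (N choose r) * ((card \<Lambda> - N) choose r)"
  using card_window_rank[of \<phi> "\<Lambda> - \<phi>" r]
  by (simp add: window_full states_of_rank_def card_virtuals card_reference)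

section \<open>Edges\<close>

text \<open>
  The window left free by \<open>\<alpha>\<close>: holes must avoid those of \<open>\<alpha>\<close>, hence lie in \<open>\<phi> \<inter> \<alpha>\<close>, and
  particles must avoid those of \<open>\<alpha>\<close>.
\<close>
abbreviation compatible_with :: "'a set \<Rightarrow> 'a set set" where
  "compatible_with \<alpha> \<equiv> window (\<phi> \<inter> \<alpha>) (\<Lambda> - \<phi> - \<alpha>)"

lemma compatible_iff_window:
  "(\<alpha>, \<beta>) \<in> compatible \<Lambda> N \<phi> \<longleftrightarrow> \<alpha> \<in> states \<Lambda> N \<and> \<beta> \<in> compatible_with \<alpha>"
proof -
  have "card (occ \<phi> \<alpha> \<union> occ \<phi> \<beta>) = N \<longleftrightarrow> \<phi> - \<beta> \<subseteq> \<phi> \<inter> \<alpha>"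
  proof
    assume "card (occ \<phi> \<alpha> \<union> occ \<phi> \<beta>) = N"
    then have "occ \<phi> \<alpha> \<union> occ \<phi> \<beta> = \<phi>"
      using card_subset_eq[OF finite_reference, of "occ \<phi> \<alpha> \<union> occ \<phi> \<beta>"] card_reference
      by (auto simp: occ_def)
    then show "\<phi> - \<beta> \<subseteq> \<phi> \<inter> \<alpha>"
      by (auto simp: occ_def)
  next
    assume "\<phi> - \<beta> \<subseteq> \<phi> \<inter> \<alpha>"
    then have "occ \<phi> \<alpha> \<union> occ \<phi> \<beta> = \<phi>"
      by (auto simp: occ_def)
    then show "card (occ \<phi> \<alpha> \<union> occ \<phi> \<beta>) = N"
      by (simp add: card_reference)
  qed
  moreover have "card (virt \<phi> \<alpha> \<inter> virt \<phi> \<beta>) = 0 \<longleftrightarrow> \<beta> - \<phi> \<subseteq> \<Lambda> - \<phi> - \<alpha>"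
    if "\<alpha> \<in> states \<Lambda> N" "\<beta> \<in> states \<Lambda> N"
    using that finite_particles[of \<alpha>] by (auto simp: virt_def states_def)
  ultimately show ?thesis
    by (auto simp: compatible_def window_def)
qed

lemma compatible_sym: "(\<alpha>, \<beta>) \<in> compatible \<Lambda> N \<phi> \<longleftrightarrow> (\<beta>, \<alpha>) \<in> compatible \<Lambda> N \<phi>"
  by (auto simp: compatible_def Un_commute Int_commute)

lemma card_compatible_with_rank:
  assumes "\<alpha> \<in> states \<Lambda> N"
  shows "card {\<beta> \<in> compatible_with \<alpha>. rk \<phi> \<beta> = s}
    = ((N - rk \<phi> \<alpha>) choose s) * ((card \<Lambda> - N - rk \<phi> \<alpha>) choose s)"
    and "card (compatible_with \<alpha>) = (card \<Lambda> - 2 * rk \<phi> \<alpha>) choose (N - rk \<phi> \<alpha>)"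
proof -
  have A: "card (\<phi> \<inter> \<alpha>) = N - rk \<phi> \<alpha>"
    using card_Int_Diff[OF finite_reference, of \<alpha>] card_holes[OF assms] card_reference by simp
  have sub: "\<alpha> - \<phi> \<subseteq> \<Lambda> - \<phi>"
    using assms by (auto simp: states_def)
  have eq: "\<Lambda> - \<phi> - \<alpha> = (\<Lambda> - \<phi>) - (\<alpha> - \<phi>)"
    by auto
  have B: "card (\<Lambda> - \<phi> - \<alpha>) = card \<Lambda> - N - rk \<phi> \<alpha>"
    using card_Diff_subset[OF finite_particles[OF assms] sub]
    by (simp add: eq card_virtuals card_particles[of \<alpha>])
  show "card {\<beta> \<in> compatible_with \<alpha>. rk \<phi> \<beta> = s}
    = ((N - rk \<phi> \<alpha>) choose s) * ((card \<Lambda> - N - rk \<phi> \<alpha>) choose s)"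
    using card_window_rank[of "\<phi> \<inter> \<alpha>" "\<Lambda> - \<phi> - \<alpha>" s] by (auto simp: A B)
  have "rk \<phi> \<alpha> \<le> card (\<Lambda> - \<phi>)"
    using card_mono[OF _ sub] finite_orbitals by (simp add: card_particles[of \<alpha>])
  then have "N - rk \<phi> \<alpha> + (card \<Lambda> - N - rk \<phi> \<alpha>) = card \<Lambda> - 2 * rk \<phi> \<alpha>"
    using rk_le[OF assms] card_virtuals card_mono[OF finite_orbitals reference_subset]
      card_reference by simp
  then show "card (compatible_with \<alpha>) = (card \<Lambda> - 2 * rk \<phi> \<alpha>) choose (N - rk \<phi> \<alpha>)"
    using card_window[of "\<phi> \<inter> \<alpha>" "\<Lambda> - \<phi> - \<alpha>"] by (auto simp: A B)
qed

lemma holes_join: "\<phi> - join \<phi> \<alpha> \<beta> = (\<phi> - \<alpha>) \<union> (\<phi> - \<beta>)"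
  and particles_join: "join \<phi> \<alpha> \<beta> - \<phi> = (\<alpha> - \<phi>) \<union> (\<beta> - \<phi>)"
  by (auto simp: join_def occ_def virt_def)

lemma
  assumes "(\<alpha>, \<beta>) \<in> compatible \<Lambda> N \<phi>"
  shows join_in_states: "join \<phi> \<alpha> \<beta> \<in> states \<Lambda> N"
    and rk_join: "rk \<phi> (join \<phi> \<alpha> \<beta>) = rk \<phi> \<alpha> + rk \<phi> \<beta>"
proof -
  have st: "\<alpha> \<in> states \<Lambda> N" "\<beta> \<in> states \<Lambda> N"
    and disj: "(\<phi> - \<alpha>) \<inter> (\<phi> - \<beta>) = {}" "(\<alpha> - \<phi>) \<inter> (\<beta> - \<phi>) = {}"
    using assms by (auto simp: compatible_iff_window window_def)
  have H: "card (\<phi> - join \<phi> \<alpha> \<beta>) = rk \<phi> \<alpha> + rk \<phi> \<beta>"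
    using st disj finite_reference by (simp add: holes_join card_Un_disjoint card_holes)
  have P: "card (join \<phi> \<alpha> \<beta> - \<phi>) = rk \<phi> \<alpha> + rk \<phi> \<beta>"
    using st disj finite_particles by (simp add: particles_join card_Un_disjoint card_particles)
  have "join \<phi> \<alpha> \<beta> \<subseteq> \<Lambda>"
    using st by (auto simp: join_def occ_def virt_def states_def)
  then show "join \<phi> \<alpha> \<beta> \<in> states \<Lambda> N"
    using H P by (simp add: states_iff_card_holes_eq_card_particles)
  show "rk \<phi> (join \<phi> \<alpha> \<beta>) = rk \<phi> \<alpha> + rk \<phi> \<beta>"
    using P by (simp add: card_particles)
qed

text \<open>
  The unions defining the holes and particles of the join are disjoint, so those of \<open>\<beta>\<close> can be
  subtracted again. Hence an arc determines the excitation that produces it.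
\<close>
lemma join_cancel:
  assumes "(\<alpha>, \<beta>) \<in> compatible \<Lambda> N \<phi>" "(\<alpha>', \<beta>) \<in> compatible \<Lambda> N \<phi>"
    and eq: "join \<phi> \<alpha> \<beta> = join \<phi> \<alpha>' \<beta>"
  shows "\<alpha> = \<alpha>'"
proof -
  have cancel: "A = B" if "A \<union> C = B \<union> C" "A \<inter> C = {}" "B \<inter> C = {}" for A B C :: "'a set"
    using that by blast
  have disj: "(\<phi> - \<alpha>) \<inter> (\<phi> - \<beta>) = {}" "(\<alpha> - \<phi>) \<inter> (\<beta> - \<phi>) = {}"
    "(\<phi> - \<alpha>') \<inter> (\<phi> - \<beta>) = {}" "(\<alpha>' - \<phi>) \<inter> (\<beta> - \<phi>) = {}"
    using assms(1,2) by (auto simp: compatible_iff_window window_def)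
  have "(\<phi> - \<alpha>) \<union> (\<phi> - \<beta>) = (\<phi> - \<alpha>') \<union> (\<phi> - \<beta>)"
    "(\<alpha> - \<phi>) \<union> (\<beta> - \<phi>) = (\<alpha>' - \<phi>) \<union> (\<beta> - \<phi>)"
    using eq by (metis holes_join, metis particles_join)
  then have "\<phi> - \<alpha> = \<phi> - \<alpha>'" "\<alpha> - \<phi> = \<alpha>' - \<phi>"
    using disj cancel[of "\<phi> - \<alpha>" "\<phi> - \<beta>" "\<phi> - \<alpha>'"]
      cancel[of "\<alpha> - \<phi>" "\<beta> - \<phi>" "\<alpha>' - \<phi>"] by meson+
  then show ?thesis
    by (rule state_eqI)
qed

lemma inj_on_join:
  "inj_on (\<lambda>(\<alpha>, \<beta>). (\<beta>, join \<phi> \<alpha> \<beta>)) (compatible \<Lambda> N \<phi>)"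
  using join_cancel by (auto simp: inj_on_def)

lemma full_edges_image:
  "full_edges \<Lambda> N \<phi> = (\<lambda>(\<alpha>, \<beta>). (\<beta>, join \<phi> \<alpha> \<beta>)) `
     (SIGMA \<alpha>:states \<Lambda> N - {\<phi>}. compatible_with \<alpha>)"
proof -
  have "(SIGMA \<alpha>:states \<Lambda> N - {\<phi>}. compatible_with \<alpha>)
      = {(\<alpha>, \<beta>). (\<alpha>, \<beta>) \<in> compatible \<Lambda> N \<phi> \<and> \<alpha> \<noteq> \<phi>}"
    by (auto simp: compatible_iff_window)
  then show ?thesis
    unfolding full_edges_def by (simp only:) force
qed

lemma card_full_edges:
  "card (full_edges \<Lambda> N \<phi>) = (\<Sum>r = 1..N.
     (N choose r) * ((card \<Lambda> - N) choose r) * ((card \<Lambda> - 2 * r) choose (N - r)))"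
proof -
  let ?f = "\<lambda>r. (card \<Lambda> - 2 * r) choose (N - r)"
  have "card (full_edges \<Lambda> N \<phi>) = card (SIGMA \<alpha>:states \<Lambda> N - {\<phi>}. compatible_with \<alpha>)"
    unfolding full_edges_image
    by (intro card_image inj_on_subset[OF inj_on_join]) (auto simp: compatible_iff_window)
  also have "\<dots> = (\<Sum>\<alpha>\<in>states \<Lambda> N - {\<phi>}. card (compatible_with \<alpha>))"
    by (intro card_SigmaI) (use finite_states finite_window in auto)
  also have "\<dots> = (\<Sum>\<alpha>\<in>states \<Lambda> N - {\<phi>}. ?f (rk \<phi> \<alpha>))"
    by (intro sum.cong refl) (simp add: card_compatible_with_rank)
  also have "states \<Lambda> N - {\<phi>} = {\<alpha>. \<alpha> \<in> window \<phi> (\<Lambda> - \<phi>) \<and> rk \<phi> \<alpha> \<in> {1..N}}"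
  proof -
    have "\<alpha> \<noteq> \<phi> \<longleftrightarrow> rk \<phi> \<alpha> \<in> {1..N}" if "\<alpha> \<in> states \<Lambda> N" for \<alpha>
      using rk_eq_0_iff[OF that] rk_le[OF that] by auto
    then show ?thesis
      unfolding window_full by blast
  qed
  also have "(\<Sum>\<alpha> | \<alpha> \<in> window \<phi> (\<Lambda> - \<phi>) \<and> rk \<phi> \<alpha> \<in> {1..N}. ?f (rk \<phi> \<alpha>)) = (\<Sum>r = 1..N.
     (N choose r) * ((card \<Lambda> - N) choose r) * ?f r)"
    by (subst sum_window_by_rank) (auto simp: card_reference card_virtuals)
  finally show ?thesis .
qed

text \<open>
  An excitation of rank \<open>s \<ge> 1\<close> differs from \<open>\<phi>\<close>, and by additivity of the rank under the join
  the arcs that raise the rank by \<open>s\<close> are those produced by excitations of rank \<open>s\<close>.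
\<close>
lemma edges_between_image:
  assumes "1 \<le> s"
  shows "edges_between \<Lambda> N \<phi> r (r + s) = (\<lambda>(\<beta>, \<alpha>). (\<beta>, join \<phi> \<alpha> \<beta>)) `
     (SIGMA \<beta>:states_of_rank \<Lambda> N \<phi> r. {\<alpha> \<in> compatible_with \<beta>. rk \<phi> \<alpha> = s})"
    (is "?E = ?J ` ?S")
proof (intro set_eqI iffI)
  fix e assume "e \<in> ?E"
  then obtain \<alpha> \<beta> where e: "e = (\<beta>, join \<phi> \<alpha> \<beta>)" and c: "(\<alpha>, \<beta>) \<in> compatible \<Lambda> N \<phi>"
    and r: "\<beta> \<in> states_of_rank \<Lambda> N \<phi> r" "rk \<phi> (join \<phi> \<alpha> \<beta>) = r + s"
    unfolding edges_between_def full_graph_def full_edges_def states_of_rank_def by force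
  have "(\<beta>, \<alpha>) \<in> ?S"
    using r rk_join[OF c] c compatible_sym[of \<alpha> \<beta>]
    by (auto simp: compatible_iff_window states_of_rank_def)
  then show "e \<in> ?J ` ?S"
    unfolding e by force
next
  fix e assume "e \<in> ?J ` ?S"
  then obtain \<alpha> \<beta> where e: "e = (\<beta>, join \<phi> \<alpha> \<beta>)" and \<beta>: "\<beta> \<in> states_of_rank \<Lambda> N \<phi> r"
    and \<alpha>: "\<alpha> \<in> compatible_with \<beta>" "rk \<phi> \<alpha> = s"
    by auto
  then have c: "(\<alpha>, \<beta>) \<in> compatible \<Lambda> N \<phi>"
    using compatible_sym[of \<alpha> \<beta>] by (auto simp: compatible_iff_window states_of_rank_def)
  moreover have "\<alpha> \<noteq> \<phi>"
    using \<alpha>(2) assms rk_eq_0_iff[OF reference] by auto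
  ultimately have "e \<in> full_edges \<Lambda> N \<phi>"
    unfolding e full_edges_def by blast
  then show "e \<in> ?E"
    using \<alpha>(2) \<beta> join_in_states[OF c] rk_join[OF c]
    by (auto simp: edges_between_def full_graph_def states_of_rank_def e)
qed

lemma card_edges_between:
  assumes "1 \<le> s"
  shows "card (edges_between \<Lambda> N \<phi> r (r + s)) = ((N choose r) * ((N - r) choose s)) *
    (((card \<Lambda> - N) choose r) * ((card \<Lambda> - N - r) choose s))"
proof -
  let ?S = "SIGMA \<beta>:states_of_rank \<Lambda> N \<phi> r. {\<alpha> \<in> compatible_with \<beta>. rk \<phi> \<alpha> = s}"
  have "inj_on (\<lambda>(\<beta>, \<alpha>). (\<beta>, join \<phi> \<alpha> \<beta>)) {(\<beta>, \<alpha>). (\<alpha>, \<beta>) \<in> compatible \<Lambda> N \<phi>}"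
    using join_cancel by (auto simp: inj_on_def)
  moreover have "?S \<subseteq> {(\<beta>, \<alpha>). (\<alpha>, \<beta>) \<in> compatible \<Lambda> N \<phi>}"
    by (subst compatible_sym) (auto simp: compatible_iff_window states_of_rank_def)
  ultimately have "inj_on (\<lambda>(\<beta>, \<alpha>). (\<beta>, join \<phi> \<alpha> \<beta>)) ?S"
    by (rule inj_on_subset)
  then have "card (edges_between \<Lambda> N \<phi> r (r + s)) = card ?S"
    unfolding edges_between_image[OF assms] by (rule card_image)
  also have "\<dots> = (\<Sum>\<beta>\<in>states_of_rank \<Lambda> N \<phi> r. card {\<alpha> \<in> compatible_with \<beta>. rk \<phi> \<alpha> = s})"
    by (intro card_SigmaI) (use finite_states finite_window in \<open>auto simp: states_of_rank_def\<close>)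
  also have "\<dots> = (\<Sum>\<beta>\<in>states_of_rank \<Lambda> N \<phi> r. ((N - r) choose s) * ((card \<Lambda> - N - r) choose s))"
    by (intro sum.cong refl) (auto simp: states_of_rank_def card_compatible_with_rank)
  finally show ?thesis
    by (simp add: card_states_of_rank)
qed

text \<open>
  The arcs without reference to the excitation. It is reconstructed as the state whose holes and
  particles are those of \<open>\<gamma>\<close> that \<open>\<beta>\<close> does not have. The rank condition singles out \<open>\<beta> \<noteq> \<gamma>\<close>
  and makes every arc increase the rank.
\<close>
lemma edge_iff:
  "(\<beta>, \<gamma>) \<in> full_edges \<Lambda> N \<phi> \<longleftrightarrow>
     \<gamma> \<in> states \<Lambda> N \<and> \<beta> \<in> window (\<phi> - \<gamma>) (\<gamma> - \<phi>) \<and> rk \<phi> \<beta> < rk \<phi> \<gamma>"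
proof
  assume "(\<beta>, \<gamma>) \<in> full_edges \<Lambda> N \<phi>"
  then obtain \<alpha> where \<gamma>: "\<gamma> = join \<phi> \<alpha> \<beta>" and c: "(\<alpha>, \<beta>) \<in> compatible \<Lambda> N \<phi>" and "\<alpha> \<noteq> \<phi>"
    by (auto simp: full_edges_def)
  moreover have "\<alpha> \<in> states \<Lambda> N" "\<beta> \<in> states \<Lambda> N"
    using c by (auto simp: compatible_iff_window window_def)
  ultimately show "\<gamma> \<in> states \<Lambda> N \<and> \<beta> \<in> window (\<phi> - \<gamma>) (\<gamma> - \<phi>) \<and> rk \<phi> \<beta> < rk \<phi> \<gamma>"
    using join_in_states[OF c] rk_join[OF c] rk_eq_0_iff[of \<alpha>]
    unfolding window_def \<gamma> holes_join particles_join by auto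
next
  assume "\<gamma> \<in> states \<Lambda> N \<and> \<beta> \<in> window (\<phi> - \<gamma>) (\<gamma> - \<phi>) \<and> rk \<phi> \<beta> < rk \<phi> \<gamma>"
  then have st: "\<gamma> \<in> states \<Lambda> N" "\<beta> \<in> states \<Lambda> N" and rk: "rk \<phi> \<beta> < rk \<phi> \<gamma>"
    and sub: "\<phi> - \<beta> \<subseteq> \<phi> - \<gamma>" "\<beta> - \<phi> \<subseteq> \<gamma> - \<phi>"
    by (auto simp: window_def)
  define \<alpha> where "\<alpha> = (\<phi> - (\<beta> - \<gamma>)) \<union> (\<gamma> - \<beta>)"
  have H: "\<phi> - \<alpha> = (\<phi> - \<gamma>) - (\<phi> - \<beta>)" and P: "\<alpha> - \<phi> = (\<gamma> - \<phi>) - (\<beta> - \<phi>)"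
    using sub by (auto simp: \<alpha>_def)
  have cH: "card (\<phi> - \<alpha>) = rk \<phi> \<gamma> - rk \<phi> \<beta>"
    unfolding H using st sub finite_reference by (simp add: card_Diff_subset card_holes)
  have cP: "card (\<alpha> - \<phi>) = rk \<phi> \<gamma> - rk \<phi> \<beta>"
    unfolding P using card_Diff_subset[OF finite_particles[OF st(2)] sub(2)]
    by (simp add: card_particles)
  have \<alpha>: "\<alpha> \<in> states \<Lambda> N"
    using cH cP st reference_subset
    by (auto simp: states_iff_card_holes_eq_card_particles \<alpha>_def)
  have "(\<alpha>, \<beta>) \<in> compatible \<Lambda> N \<phi>"
    using \<alpha> st H P by (auto simp: compatible_iff_window window_def states_def)
  moreover have "\<alpha> \<noteq> \<phi>"
    using cP rk by auto
  moreover have "\<gamma> = join \<phi> \<alpha> \<beta>"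
    by (rule state_eqI) (use sub in \<open>auto simp: holes_join particles_join H P\<close>)
  ultimately show "(\<beta>, \<gamma>) \<in> full_edges \<Lambda> N \<phi>"
    unfolding full_edges_def by blast
qed

end

section \<open>Walks and compositions\<close>

lemma finite_directed_paths:
  assumes "finite (parcs G)"
  shows "finite (directed_paths G n u v)"
  by (rule finite_subset[OF _ finite_lists_length_eq[OF assms, of n]])
    (auto simp: directed_paths_def pre_digraph.awalk_def)

lemma directed_paths_0:
  "u \<in> pverts G \<Longrightarrow> directed_paths G 0 u v = (if u = v then {[]} else {})"
  by (auto simp: directed_paths_def pre_digraph.awalk_def pre_digraph.cas.simps)

text \<open>
  Splitting off the last arc, rather than the first, keeps the start fixed and leaves the
  end free, which is what the induction on the length requires.
\<close>
lemma directed_paths_Suc: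
  "directed_paths G (Suc n) u v
     = (\<Union>w\<in>{w. (w, v) \<in> parcs G}. (\<lambda>p. p @ [(w, v)]) ` directed_paths G n u w)"
proof -
  have cas: "pre_digraph.cas (with_proj G) u (p @ [e]) v
      \<longleftrightarrow> pre_digraph.cas (with_proj G) u p (fst e) \<and> snd e = v" for p e and u :: 'a
    by (induction p arbitrary: u) (auto simp: pre_digraph.cas.simps)
  show ?thesis
  proof (intro set_eqI iffI)
    fix p assume p: "p \<in> directed_paths G (Suc n) u v"
    then obtain q e where "p = q @ [e]"
      by (cases p rule: rev_cases) (auto simp: directed_paths_def)
    then show "p \<in> (\<Union>w\<in>{w. (w, v) \<in> parcs G}. (\<lambda>p. p @ [(w, v)]) ` directed_paths G n u w)"
      using p by (cases e) (auto simp: directed_paths_def pre_digraph.awalk_def cas)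
  qed (auto simp: directed_paths_def pre_digraph.awalk_def cas)
qed

lemma card_directed_paths_Suc:
  assumes "finite (parcs G)"
  shows "card (directed_paths G (Suc n) u v)
    = (\<Sum>w | (w, v) \<in> parcs G. card (directed_paths G n u w))"
proof -
  have "{w. (w, v) \<in> parcs G} \<subseteq> fst ` parcs G"
    by force
  then have "finite {w. (w, v) \<in> parcs G}"
    using assms finite_subset by blast
  then show ?thesis
    unfolding directed_paths_Suc
    by (subst card_UN_disjoint)
      (auto simp: finite_directed_paths[OF assms] card_image inj_on_def)
qed

lemma positive_compositions_0: "positive_compositions r 0 = (if r = 0 then {[]} else {})"
  by (auto simp: positive_compositions_def)

lemma positive_compositions_Suc:
  "positive_compositions r (Suc n)
     = (\<Union>k<r. (\<lambda>rs. (r - k) # rs) ` positive_compositions k n)"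
proof (intro set_eqI iffI)
  fix xs assume "xs \<in> positive_compositions r (Suc n)"
  then obtain x rs where xs: "xs = x # rs" "1 \<le> x" "x + sum_list rs = r"
    and rs: "rs \<in> positive_compositions (sum_list rs) n"
    by (cases xs) (auto simp: positive_compositions_def)
  then have "sum_list rs < r" "x = r - sum_list rs"
    by auto
  then show "xs \<in> (\<Union>k<r. (\<lambda>rs. (r - k) # rs) ` positive_compositions k n)"
    using rs xs(1) by blast
qed (auto simp: positive_compositions_def)

lemma finite_positive_compositions: "finite (positive_compositions r n)"
  by (induction n arbitrary: r)
    (auto simp: positive_compositions_0 positive_compositions_Suc)

lemma path_number_0: "path_number r 0 = (if r = 0 then 1 else 0)"
  by (simp add: path_number_def positive_compositions_0)

text \<open>
  With first part \<open>r - k\<close>, the multinomial coefficient of \<open>r\<close> factors as \<open>r choose k\<close> times the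
  multinomial coefficient of \<open>k\<close> for the remaining parts. The weight \<open>(r choose k)\<^sup>2\<close> is also
  the number of predecessors of rank \<open>k\<close> of a state of rank \<open>r\<close>.
\<close>
lemma path_number_Suc:
  "path_number r (Suc n) = (\<Sum>k<r. (real (r choose k))\<^sup>2 * path_number k n)"
proof -
  let ?g = "\<lambda>rs. (fact r / (\<Prod>i<Suc n. fact (rs ! i)) :: real)\<^sup>2"
  have "path_number r (Suc n)
      = (\<Sum>k<r. \<Sum>xs\<in>(\<lambda>rs. (r - k) # rs) ` positive_compositions k n. ?g xs)"
    unfolding path_number_def positive_compositions_Suc
    by (subst sum.UNION_disjoint) (auto simp: finite_positive_compositions)
  also have "\<dots> = (\<Sum>k<r. \<Sum>rs\<in>positive_compositions k n. ?g ((r - k) # rs))"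
    by (simp add: sum.reindex)
  also have "\<dots> = (\<Sum>k<r. (real (r choose k))\<^sup>2 * path_number k n)"
    unfolding path_number_def sum_distrib_left
  proof (intro sum.cong refl)
    fix k rs assume "k \<in> {..<r}"
    then have "real (r choose k) = fact r / (fact k * fact (r - k))"
      by (simp add: binomial_fact)
    then show "?g ((r - k) # rs)
        = (real (r choose k))\<^sup>2 * (fact k / (\<Prod>i<n. fact (rs ! i)))\<^sup>2"
      by (simp only: prod.lessThan_Suc_shift) (simp add: power_divide power_mult_distrib)
  qed
  finally show ?thesis .
qed

context reference_state
begin

lemma finite_full_edges: "finite (full_edges \<Lambda> N \<phi>)"
  unfolding full_edges_image using finite_states finite_window
  by (intro finite_imageI finite_SigmaI) auto

text \<open>
  Induction on the length from \<open>n = 0\<close>, where both sides are \<open>1\<close> for \<open>\<gamma> = \<phi>\<close> and \<open>0\<close>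
  otherwise; for lengths exceeding the rank both sides vanish.
\<close>
lemma card_directed_paths_from_reference:
  assumes "\<gamma> \<in> states \<Lambda> N"
  shows "real (card (directed_paths (full_graph \<Lambda> N \<phi>) n \<phi> \<gamma>)) = path_number (rk \<phi> \<gamma>) n"
  using assms
proof (induction n arbitrary: \<gamma>)
  case 0
  then show ?case
    using reference rk_eq_0_iff[OF 0] by (auto simp: directed_paths_0 path_number_0 full_graph_def)
next
  case (Suc n)
  let ?G = "full_graph \<Lambda> N \<phi>" and ?r = "rk \<phi> \<gamma>"
  let ?W = "{\<beta>. \<beta> \<in> window (\<phi> - \<gamma>) (\<gamma> - \<phi>) \<and> rk \<phi> \<beta> \<in> {..<?r}}"
  have "{\<beta>. (\<beta>, \<gamma>) \<in> parcs ?G} = ?W"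
    using Suc.prems by (auto simp: full_graph_def edge_iff)
  moreover have "finite (parcs ?G)"
    by (simp add: full_graph_def finite_full_edges)
  ultimately have "real (card (directed_paths ?G (Suc n) \<phi> \<gamma>))
      = (\<Sum>\<beta>\<in>?W. real (card (directed_paths ?G n \<phi> \<beta>)))"
    by (simp add: card_directed_paths_Suc)
  also have "\<dots> = (\<Sum>\<beta>\<in>?W. path_number (rk \<phi> \<beta>) n)"
    by (intro sum.cong refl Suc.IH) (auto simp: window_def)
  also have "\<dots> = (\<Sum>k<?r. (real (?r choose k))\<^sup>2 * path_number k n)"
    using Suc.prems
    by (subst sum_window_by_rank)
      (auto simp: card_holes card_particles states_def power2_eq_square)
  finally show ?case
    by (simp add: path_number_Suc)
qed

end

section \<open>The counting theorem\<close>

text \<open>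
  Choosing an \<open>r\<close>-set and then an \<open>s\<close>-set disjoint from it amounts to choosing their union
  and then the \<open>r\<close>-set inside it. If \<open>r + s > n\<close>, both sides are \<open>0\<close>, truncated subtraction
  included.
\<close>
lemma choose_mult_choose_diff:
  "(n choose r) * ((n - r) choose s) = (n choose (r + s)) * ((r + s) choose r)" for n r s :: nat
proof (cases "r + s \<le> n")
  case True
  then show ?thesis
    using choose_mult[of r "r + s" n] by simp
next
  case False
  then show ?thesis
    by (cases "r \<le> n") (auto simp: binomial_eq_0)
qed

theorem theoremA1:
  fixes \<Lambda> :: "'a set" and \<phi> :: "'a set" and K N :: nat
  assumes "finite \<Lambda>" and "card \<Lambda> = K" and "1 \<le> N" and "2 * N \<le> K"
    and "\<phi> \<in> states \<Lambda> N"
  shows "card (pverts (full_graph \<Lambda> N \<phi>)) = K choose N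
    \<and> (\<forall>r. card (states_of_rank \<Lambda> N \<phi> r) = (N choose r) * ((K - N) choose r))
    \<and> (\<forall>r. edges_between \<Lambda> N \<phi> r r = {})
    \<and> (\<forall>r\<in>{0..N}. \<forall>s\<in>{1..N - r}. card (edges_between \<Lambda> N \<phi> r (r + s)) =
         ((K - N) choose r) * ((K - N - r) choose s) * (N choose (s + r)) * ((s + r) choose r))
    \<and> (\<forall>r\<in>{0..N}. \<forall>s\<in>{N - r + 1..N}. card (edges_between \<Lambda> N \<phi> r (r + s)) = 0)
    \<and> (\<forall>r\<ge>1. \<forall>s\<ge>1. card (edges_between \<Lambda> N \<phi> r (r + s))
         = card (edges_between \<Lambda> N \<phi> s (r + s)))
    \<and> card (parcs (full_graph \<Lambda> N \<phi>)) =
         (\<Sum>r = 1..N. (N choose r) * ((K - N) choose r) * ((K - 2 * r) choose (N - r)))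
    \<and> (\<forall>\<gamma>\<in>pverts (full_graph \<Lambda> N \<phi>). \<forall>n. 1 \<le> n \<and> n \<le> rk \<phi> \<gamma> \<longrightarrow>
         real (card (directed_paths (full_graph \<Lambda> N \<phi>) n \<phi> \<gamma>)) = path_number (rk \<phi> \<gamma>) n)"
proof -
  interpret reference_state \<Lambda> \<phi> N
    using assms by unfold_locales
  have K: "card \<Lambda> = K"
    by fact
  have edges: "card (edges_between \<Lambda> N \<phi> r (r + s)) = ((K - N) choose r) * ((K - N - r) choose s)
      * (N choose (s + r)) * ((s + r) choose r)" if "1 \<le> s" for r s
    using card_edges_between[OF that] choose_mult_choose_diff[of N r s]
    by (simp add: K ac_simps)
  have sym: "card (edges_between \<Lambda> N \<phi> r (r + s)) = card (edges_between \<Lambda> N \<phi> s (r + s))"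
    if "1 \<le> r" "1 \<le> s" for r s
  proof -
    \<comment> \<open>Both sides count the ordered pairs of disjoint subsets of sizes \<open>r\<close> and \<open>s\<close> of an \<open>n\<close>-set.\<close>
    have comm: "(n choose r) * ((n - r) choose s) = (n choose s) * ((n - s) choose r)" for n
      using binomial_symmetric[of r "r + s"]
      by (simp add: choose_mult_choose_diff add.commute[of s r])
    have "card (edges_between \<Lambda> N \<phi> s (s + r)) = card (edges_between \<Lambda> N \<phi> r (r + s))"
      unfolding card_edges_between[OF that(1)] card_edges_between[OF that(2)] comm ..
    then show ?thesis
      by (simp add: add.commute)
  qed
  have "card (states \<Lambda> N) = K choose N"
    using n_subsets[OF assms(1)] by (simp add: states_def K)
  moreover have "edges_between \<Lambda> N \<phi> r r = {}" for r
    by (auto simp: edges_between_def full_graph_def edge_iff states_of_rank_def)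
  moreover have "card (edges_between \<Lambda> N \<phi> r (r + s)) = 0" if "s \<in> {N - r + 1..N}" for r s
  proof -
    have "N choose (s + r) = 0" "1 \<le> s"
      using that by (auto simp: binomial_eq_0)
    then show ?thesis
      by (simp add: edges)
  qed
  ultimately show ?thesis
    using edges sym card_states_of_rank card_full_edges card_directed_paths_from_reference
    by (simp add: full_graph_def K)
qed

end
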